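(* For any positive integer $m$, there exists a non-mid-point reducible subset $S\subseteq \mathbb{Z}_m^2$ of size $|S|\ge \frac{7}{24}\cdot m^2$.
   Context: $\mathbb{Z}_m=\mathbb{Z}/m\mathbb{Z}$ denotes the integers modulo $m$. For a subset $S\subseteq \mathbb{Z}_m^d$, a point $y\in S$ is called a non-mid-point of $S$ if there is no solution to the equation $2y=x+z$ with distinct $x,z\in S$. A subset $S\subseteq \mathbb{Z}_m^d$ is called non-mid-point reducible if for every non-empty subset $S'\subseteq S$, some point $y\in S'$ is a non-mid-point of $S'$. *)

theory Defs
  imports Complex_Main "HOL-Library.FuncSet" "HOL-Number_Theory.Cong"
begin

text \<open>
  Elements of \<open>\<int>\<^sub>m\<close> are represented by their least non-negative residues, and elements of
  \<open>\<int>\<^sub>m\<^sup>d\<close> by extensional functions on the index set \<open>{..<d}\<close>, so that equality of elements is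
  equality in HOL. The group operation enters only through coordinatewise congruence modulo \<open>m\<close>.
\<close>

definition residue_space :: "nat \<Rightarrow> nat \<Rightarrow> (nat \<Rightarrow> int) set" where
  "residue_space m d = {..<d} \<rightarrow>\<^sub>E {0..<int m}"

definition non_mid_point :: "nat \<Rightarrow> nat \<Rightarrow> (nat \<Rightarrow> int) set \<Rightarrow> (nat \<Rightarrow> int) \<Rightarrow> bool" where
  "non_mid_point m d S y \<longleftrightarrow> y \<in> S \<and>
     \<not> (\<exists>x\<in>S. \<exists>z\<in>S. x \<noteq> z \<and> (\<forall>i<d. [2 * y i = x i + z i] (mod int m)))"

definition non_mid_point_reducible :: "nat \<Rightarrow> nat \<Rightarrow> (nat \<Rightarrow> int) set \<Rightarrow> bool" where
  "non_mid_point_reducible m d S \<longleftrightarrow> S \<subseteq> residue_space m d \<and>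
     (\<forall>S'\<subseteq>S. S' \<noteq> {} \<longrightarrow> (\<exists>y\<in>S'. non_mid_point m d S' y))"

end

theory Submission
  imports Defs
begin

text \<open>
  A set is non-mid-point reducible as soon as its points can be ranked so that every mid-point of
  two distinct points ranks below one of them. Rank \<open>(u, b)\<close> lexicographically by \<open>u\<close> and
  \<open>2 b mod m\<close>. Then only solutions of \<open>2 y = x + z\<close> with \<open>x\<^sub>1 + z\<^sub>1 = 2 y\<^sub>1 - m\<close> can do harm. Give row
  \<open>u < m / 2\<close> the interval \<open>{0..<min (m / 2) (u + m / 6)}\<close>; for rows with \<open>x\<^sub>1 + z\<^sub>1 = s\<close> the sums
  \<open>x\<^sub>2 + z\<^sub>2\<close> all lie below \<open>s + m / 3\<close>. Hence row \<open>u \<ge> m / 2\<close> may contain every \<open>b\<close> with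
  \<open>2 b mod m \<ge> max (m / 2) (2 u - m + m / 3)\<close>. These \<open>b\<close> form two intervals which differ by a shift of
  \<open>m / 2\<close> and have the same doubles; this is the gain over the density \<open>1 / 4\<close> of a square. Taking
  \<open>u < 3 m / 4\<close> gives density \<open>7 / 36 + 7 / 72 = 7 / 24\<close>. Rounding is harmless unless
  \<open>m = 2 n\<close> with \<open>n\<close> odd, and then the preimage of a solution modulo \<open>n\<close> works.
\<close>

section \<open>Rankings as certificates of reducibility\<close>

definition ranked :: "nat \<Rightarrow> (nat \<times> nat) set \<Rightarrow> (nat \<times> nat \<Rightarrow> nat) \<Rightarrow> bool" where
  "ranked m P r \<longleftrightarrow> P \<subseteq> {..<m} \<times> {..<m} \<and>
     (\<forall>x\<in>P. \<forall>y\<in>P. \<forall>z\<in>P. x \<noteq> z \<longrightarrow> [2 * fst y = fst x + fst z] (mod m) \<longrightarrow>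
        [2 * snd y = snd x + snd z] (mod m) \<longrightarrow> r y < r x \<or> r y < r z)"

text \<open>In any non-empty subset a point of maximal rank is a non-mid-point: otherwise one of the
  two points it halves would outrank it.\<close>

lemma non_mid_point_reducible_if_ranked:
  assumes "ranked m P r"
  shows "\<exists>S. S \<subseteq> residue_space m 2 \<and> non_mid_point_reducible m 2 S \<and> card S = card P"
proof -
  define F where "F = (\<lambda>(u, b). \<lambda>i\<in>{..<2::nat}. if i = 0 then int u else int b)"
  have F0: "F x 0 = int (fst x)" and F1: "F x 1 = int (snd x)" for x
    by (auto simp: F_def split: prod.splits)
  have inj: "inj F"
    by (rule injI) (metis F0 F1 nat_int prod_eqI)
  have P: "P \<subseteq> {..<m} \<times> {..<m}"
    using assms by (simp add: ranked_def)
  have sub: "F ` P \<subseteq> residue_space m 2"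
    using P by (fastforce simp: residue_space_def F_def PiE_iff extensional_def split: if_splits)
  have "\<exists>y\<in>S'. non_mid_point m 2 S' y" if S': "S' \<subseteq> F ` P" "S' \<noteq> {}" for S'
  proof -
    obtain Q where Q: "Q \<subseteq> P" "S' = F ` Q"
      using S'(1) by (meson subset_imageE)
    have "finite Q"
      using finite_subset[OF P] Q(1) finite_subset by blast
    moreover have "Q \<noteq> {}"
      using Q S' by auto
    ultimately have "Max (r ` Q) \<in> r ` Q"
      by (intro Max_in) auto
    then obtain y where "y \<in> Q" "Max (r ` Q) = r y"
      by auto
    then have y: "y \<in> Q" "\<And>x. x \<in> Q \<Longrightarrow> r x \<le> r y"
      using \<open>finite Q\<close> by (metis Max_ge finite_imageI imageI)+
    have "non_mid_point m 2 S' (F y)"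
      unfolding non_mid_point_def
    proof (intro conjI notI)
      show "F y \<in> S'"
        using Q y by simp
      assume "\<exists>x\<in>S'. \<exists>z\<in>S'. x \<noteq> z \<and> (\<forall>i<2. [2 * F y i = x i + z i] (mod int m))"
      then obtain x z where xz: "x \<in> Q" "z \<in> Q" "x \<noteq> z"
        and c: "\<forall>i<2. [2 * F y i = F x i + F z i] (mod int m)"
        using Q(2) by auto
      have "[int (2 * fst y) = int (fst x + fst z)] (mod int m)"
        using c[rule_format, of 0] by (simp add: F0)
      moreover have "[int (2 * snd y) = int (snd x + snd z)] (mod int m)"
        using c[rule_format, of 1] F1 by simp
      ultimately have "r y < r x \<or> r y < r z"
        using assms xz y(1) Q(1) unfolding ranked_def cong_int_iff by blast
      then show False
        using y(2) xz by (meson not_le)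
    qed
    then show ?thesis
      using Q y by blast
  qed
  with sub have "non_mid_point_reducible m 2 (F ` P)"
    by (simp add: non_mid_point_reducible_def)
  with sub show ?thesis
    using card_image[of F P] inj by (meson inj_on_subset subset_UNIV)
qed

section \<open>Congruences of naturals, and lifting from an odd modulus to its double\<close>

lemma cong_nat_close_imp_eq:
  fixes a b m :: nat
  assumes "[a = b] (mod m)" "a < b + m" "b < a + m"
  shows "a = b"
proof -
  have "int m dvd int a - int b"
    using assms(1) by (metis cong_iff_dvd_diff cong_int_iff)
  then have "int a - int b = 0"
    using dvd_imp_le_int[of "int a - int b" "int m"] assms(2,3) by linarith
  then show ?thesis by simp
qed

text \<open>The even modulus forces \<open>a + c\<close> to be even. Since \<open>a\<close> and
  \<open>c\<close> differ by 0 or by the odd number \<open>n\<close>, only the difference 0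
  remains.\<close>

lemma eq_of_even_sum_cong:
  fixes a b c n :: nat
  assumes "odd n" "a < 2 * n" "c < 2 * n" "a mod n = c mod n" "[2 * b = a + c] (mod 2 * n)"
  shows "a = c"
proof -
  have "[2 * b = a + c] (mod 2)"
    using assms(5) by (rule cong_modulus_mult_nat)
  then have "even (a + c)"
    by (simp add: cong_def) presburger
  moreover have "a = c \<or> a = c + n \<or> c = a + n"
  proof -
    have "w = w mod n \<or> w = w mod n + n" if "w < 2 * n" for w
      using that by (cases "w < n") (auto simp: le_mod_geq)
    with assms(2-4) show ?thesis by metis
  qed
  ultimately show ?thesis
    using assms(1) by auto
qed

text \<open>The witness is the full preimage of \<open>P\<close> under reduction modulo
  \<open>n\<close>, ranked through the reduction; each point has four preimages. Two distinct points
  over the same point have no mid-point because \<open>n\<close> is odd, so every solution reduces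
  to one with distinct end points.\<close>

lemma ranked_double:
  assumes "ranked n P r" "odd n"
  shows "\<exists>P' r'. ranked (2 * n) P' r' \<and> card P' = 4 * card P"
proof -
  define red where "red = (\<lambda>x. (fst x mod n, snd x mod n))"
  define F where "F = (\<lambda>(x, i, j). (fst x + n * i, snd x + n * j))"
  let ?D = "P \<times> {0, 1} \<times> {0, 1 :: nat}"
  have P: "P \<subseteq> {..<n} \<times> {..<n}"
    using assms by (simp add: ranked_def)
  have red_F: "red (F (x, i, j)) = x" if "x \<in> P" for x i j
    using that P by (auto simp: red_def F_def)
  have inj: "inj_on F ?D"
  proof (rule inj_onI)
    fix a b assume ab: "a \<in> ?D" "b \<in> ?D" "F a = F b"
    obtain x i j x' i' j' where e: "a = (x, i, j)" "b = (x', i', j')"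
      by (metis prod.exhaust)
    have "x = x'"
      using ab red_F unfolding e by (metis SigmaE2)
    then show "a = b"
      using ab \<open>odd n\<close> odd_pos by (auto simp: e F_def)
  qed
  have "ranked (2 * n) (F ` ?D) (r \<circ> red)"
    unfolding ranked_def
  proof (intro conjI ballI impI)
    show "F ` ?D \<subseteq> {..<2 * n} \<times> {..<2 * n}"
      using P by (fastforce simp: F_def)
    fix x y z assume xyz: "x \<in> F ` ?D" "y \<in> F ` ?D" "z \<in> F ` ?D" "x \<noteq> z"
      and c: "[2 * fst y = fst x + fst z] (mod 2 * n)" "[2 * snd y = snd x + snd z] (mod 2 * n)"
    have bound: "fst w < 2 * n \<and> snd w < 2 * n" if "w \<in> F ` ?D" for w
      using that P by (fastforce simp: F_def)
    have "red x \<noteq> red z"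
    proof
      assume "red x = red z"
      then have "fst x = fst z" "snd x = snd z"
        using eq_of_even_sum_cong[OF \<open>odd n\<close> _ _ _ c(1)] eq_of_even_sum_cong[OF \<open>odd n\<close> _ _ _ c(2)]
          bound[OF xyz(1)] bound[OF xyz(3)] by (auto simp: red_def)
      with \<open>x \<noteq> z\<close> show False by (simp add: prod_eq_iff)
    qed
    moreover have "[2 * fst y = fst x + fst z] (mod n)" "[2 * snd y = snd x + snd z] (mod n)"
      using c by (auto simp: mult.commute[of 2 n] dest: cong_modulus_mult_nat)
    then have "[2 * fst (red y) = fst (red x) + fst (red z)] (mod n)"
      "[2 * snd (red y) = snd (red x) + snd (red z)] (mod n)"
      by (auto simp: red_def cong_def mod_simps)
    moreover have "red w \<in> P" if w: "w \<in> F ` ?D" for w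
    proof -
      obtain p i j where "w = F (p, i, j)" "p \<in> P"
        using w by blast
      then show ?thesis by (simp add: red_F)
    qed
    then have "red x \<in> P" "red y \<in> P" "red z \<in> P"
      using xyz(1-3) by metis+
    ultimately show "(r \<circ> red) y < (r \<circ> red) x \<or> (r \<circ> red) y < (r \<circ> red) z"
      using assms(1) unfolding ranked_def o_def by metis
  qed
  moreover have "card (F ` ?D) = 4 * card P"
    using card_image[OF inj] by (simp add: card_cartesian_product)
  ultimately show ?thesis by blast
qed

section \<open>The rows, the staircase and its ranking\<close>

definition early_row :: "nat \<Rightarrow> nat \<Rightarrow> nat \<Rightarrow> nat set" where
  "early_row h k u = {..<min h (u + k)}"

text \<open>The cap \<open>m - h\<close> confines the doubles of a row to a window so short that congruences between
  sums of two of them are equalities.\<close>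

definition late_row :: "nat \<Rightarrow> nat \<Rightarrow> nat \<Rightarrow> nat set" where
  "late_row m h A = {b. b < m \<and> max A (m - h) \<le> 2 * b mod m}"

text \<open>With \<open>k\<close> near m / 6 the threshold is 2 u - m + m / 3 up to rounding. It is
  written as an even number because for even \<open>m\<close> all doubles modulo \<open>m\<close>
  are even.\<close>

definition rows :: "nat \<Rightarrow> nat \<Rightarrow> nat \<Rightarrow> nat \<Rightarrow> nat set" where
  "rows m h k u = (if u < h then early_row h k u else late_row m h (2 * k + 2 * (u - h)))"

lemma two_halves:
  fixes m h :: nat
  assumes "h = (m + 1) div 2"
  shows "m \<le> 2 * h" "2 * h \<le> m + 1"
  unfolding assms by presburger+

text \<open>In an early row neither the sums nor the doubles wrap around. In a late row the argument
  runs on the doubles: that of \<open>y\<close> is the exact mean of those of \<open>x\<close> and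
  \<open>z\<close>.\<close>

lemma rows_convex:
  fixes m h :: nat
  assumes h: "h = (m + 1) div 2" and "m > 0"
    and x: "x \<in> rows m h k u" and y: "y \<in> rows m h k u" and z: "z \<in> rows m h k u"
    and "x \<noteq> z" and c: "[2 * y = x + z] (mod m)"
  shows "2 * y mod m < 2 * x mod m \<or> 2 * y mod m < 2 * z mod m"
proof (cases "u < h")
  case True
  then have l: "x < h" "y < h" "z < h"
    using x y z by (auto simp: rows_def early_row_def)
  have "2 * y = x + z"
    using l two_halves[OF h] by (intro cong_nat_close_imp_eq[OF c]) auto
  moreover have "2 * x < m" "2 * y < m" "2 * z < m"
    using l two_halves[OF h] by auto
  ultimately show ?thesis
    using \<open>x \<noteq> z\<close> by auto
next
  case False
  then have l: "m - h \<le> 2 * x mod m" "m - h \<le> 2 * y mod m" "m - h \<le> 2 * z mod m" "x < m" "z < m"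
    using x y z by (auto simp: rows_def late_row_def)
  have ub: "2 * x mod m < m" "2 * y mod m < m" "2 * z mod m < m"
    using \<open>m > 0\<close> by auto
  have "[2 * (2 * y) = 2 * (x + z)] (mod m)"
    using c by (rule cong_scalar_left)
  then have "[2 * (2 * y mod m) = 2 * x mod m + 2 * z mod m] (mod m)"
    by (simp add: cong_def mod_simps distrib_left)
  then have e: "2 * (2 * y mod m) = 2 * x mod m + 2 * z mod m"
  proof (rule cong_nat_close_imp_eq)
    show "2 * (2 * y mod m) < 2 * x mod m + 2 * z mod m + m"
      and "2 * x mod m + 2 * z mod m < 2 * (2 * y mod m) + m"
      using l ub two_halves[OF h] by linarith+
  qed
  show ?thesis
  proof (rule ccontr)
    \<comment> \<open>A mean below neither term makes all three doubles equal. Doubling need not be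
      injective, but 2 x = x + z can still be cancelled.\<close>
    assume "\<not> ?thesis"
    with e have "2 * x mod m = 2 * y mod m" by auto
    with c have "[x + x = x + z] (mod m)"
      by (simp add: cong_def mult_2)
    then have "[x = z] (mod m)"
      by (simp add: cong_add_lcancel_nat)
    with l \<open>x \<noteq> z\<close> show False
      by (simp add: cong_less_modulus_unique_nat)
  qed
qed

definition staircase :: "nat \<Rightarrow> nat \<Rightarrow> nat \<Rightarrow> (nat \<times> nat) set" where
  "staircase m h k = Sigma {..<h + (m + 1) div 4} (rows m h k)"

lemma ranked_staircase:
  fixes m h k :: nat
  assumes h: "h = (m + 1) div 2" and "m > 0"
  shows "ranked m (staircase m h k) (\<lambda>x. fst x * m + 2 * snd x mod m)"
  unfolding ranked_def
proof (intro conjI ballI impI)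
  have hm: "h \<le> m" "h + (m + 1) div 4 \<le> m"
    unfolding h using \<open>m > 0\<close> by presburger+
  show "staircase m h k \<subseteq> {..<m} \<times> {..<m}"
  proof
    fix x assume "x \<in> staircase m h k"
    then have "fst x < h + (m + 1) div 4" "snd x < max h m"
      by (auto simp: staircase_def rows_def early_row_def late_row_def split: if_splits)
    with hm show "x \<in> {..<m} \<times> {..<m}"
      by (simp add: mem_Times_iff max_absorb2)
  qed
  fix x y z
  assume "x \<in> staircase m h k" "y \<in> staircase m h k" "z \<in> staircase m h k" "x \<noteq> z"
    "[2 * fst y = fst x + fst z] (mod m)" "[2 * snd y = snd x + snd z] (mod m)"
  moreover obtain x1 x2 y1 y2 z1 z2 where e: "x = (x1, x2)" "y = (y1, y2)" "z = (z1, z2)"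
    by (metis prod.exhaust)
  ultimately have c1: "[2 * y1 = x1 + z1] (mod m)" and c2: "[2 * y2 = x2 + z2] (mod m)"
    and u: "x1 < h + (m + 1) div 4" "y1 < h + (m + 1) div 4" "z1 < h + (m + 1) div 4"
    and b: "x2 \<in> rows m h k x1" "y2 \<in> rows m h k y1" "z2 \<in> rows m h k z1"
    and ne: "(x1, x2) \<noteq> (z1, z2)"
    by (auto simp: staircase_def)
  have lex: "u * m + v mod m < u' * m + v' mod m" if "u < u'" for u u' v v' :: nat
  proof -
    have "u * m + v mod m < Suc u * m"
      using \<open>m > 0\<close> by simp
    also have "\<dots> \<le> u' * m"
      using that by (intro mult_le_mono1) simp
    finally show ?thesis by simp
  qed
  consider "y1 < x1" | "y1 < z1" | "x1 = y1" "z1 = y1" | "x1 \<le> y1" "z1 \<le> y1" "x1 + z1 < 2 * y1"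
    by linarith
  then show "fst y * m + 2 * snd y mod m < fst x * m + 2 * snd x mod m \<or>
      fst y * m + 2 * snd y mod m < fst z * m + 2 * snd z mod m"
  proof cases
    case 1
    then show ?thesis using lex by (simp add: e)
  next
    case 2
    then show ?thesis using lex by (simp add: e)
  next
    case 3
    then have "x2 \<in> rows m h k y1" "z2 \<in> rows m h k y1" "x2 \<noteq> z2"
      using b ne by simp_all
    from rows_convex[OF h \<open>m > 0\<close> this(1) b(2) this(2,3) c2] 3 show ?thesis
      by (simp add: e)
  next
    case 4
    \<comment> \<open>The first coordinates wrap around exactly once: the two sides are congruent,
      the right one is smaller, and \<open>y1 < m\<close>.\<close>
    have eq: "2 * y1 = x1 + z1 + m"
    proof (rule cong_nat_close_imp_eq)
      show "[2 * y1 = x1 + z1 + m] (mod m)"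
        using c1 by (simp add: cong_def)
      show "2 * y1 < x1 + z1 + m + m"
        using u hm by linarith
      show "x1 + z1 + m < 2 * y1 + m"
        using 4 by simp
    qed
    \<comment> \<open>Stopping after \<open>(m + 1) div 4\<close> late rows keeps
      \<open>x1 + z1 = 2 * y1 - m\<close> below \<open>h\<close>, so both outer rows are
      early.\<close>
    have "4 * ((m + 1) div 4) \<le> m + 1"
      by simp
    then have y1: "h \<le> y1" and xz1: "x1 < h" "z1 < h"
      using eq u two_halves[OF h] by linarith+
    then have xz_sum: "x1 + z1 \<le> 1 + 2 * (y1 - h)"
      using eq two_halves[OF h] by linarith
    have "x2 < min h (x1 + k)" "z2 < min h (z1 + k)"
      using b xz1 by (auto simp: rows_def early_row_def)
    then have "x2 < h" "x2 < x1 + k" "z2 < h" "z2 < z1 + k"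
      by simp_all
    \<comment> \<open>The two strict bounds save 2, which absorbs the 1 lost in
      \<open>xz_sum\<close> when \<open>m\<close> is odd. So \<open>x2 + z2\<close> misses the late
      row of \<open>y2\<close>.\<close>
    then have "x2 + z2 < m" and lt: "x2 + z2 < 2 * k + 2 * (y1 - h)"
      using two_halves[OF h] xz_sum by linarith+
    then have "2 * y2 mod m = x2 + z2"
      using c2 by (simp add: cong_def)
    moreover have "2 * k + 2 * (y1 - h) \<le> 2 * y2 mod m"
      using b y1 by (auto simp: rows_def late_row_def)
    ultimately show ?thesis
      using lt by simp
  qed
qed

section \<open>Counting the points of the staircase\<close>

lemma card_late_row:
  fixes m h A :: nat
  assumes h: "h = (m + 1) div 2" and "odd m \<or> 4 dvd m" and "even A"
  shows "int (card (late_row m h A)) \<ge> min (int h) (int m - int A)"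
proof (cases "A \<le> m")
  case True
  define B where "B = max A (m - h)"
  \<comment> \<open>For even \<open>m\<close> an odd bound \<open>B\<close> would cost one point, as
    only even doubles occur.\<close>
  have "odd m \<or> even (m - h)"
    using assms(2) unfolding h by presburger
  then have B: "B \<le> m" "odd m \<or> even B"
    using True \<open>even A\<close> by (auto simp: B_def max_def)
  \<comment> \<open>Doubling does not wrap on \<open>?I\<close> and wraps once on \<open>?J\<close>.
    For even \<open>m\<close> both give the same doubles; for odd \<open>m\<close> they give the
    even and the odd ones.\<close>
  let ?I = "{(B + 1) div 2..<h}" and ?J = "{(m + B + 1) div 2..<m}"
  have "?I \<union> ?J \<subseteq> late_row m h A"
  proof
    fix b assume "b \<in> ?I \<union> ?J"
    then show "b \<in> late_row m h A"
    proof
      assume "b \<in> ?I"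
      then have "(B + 1) div 2 \<le> b" "b < h" by auto
      then have "2 * b < m" "B \<le> 2 * b"
        using two_halves[OF h] by linarith+
      then show ?thesis by (simp add: late_row_def B_def[symmetric])
    next
      assume b: "b \<in> ?J"
      then have "(m + B + 1) div 2 \<le> b" "b < m" by auto
      then have "m + B \<le> 2 * b" "2 * b - m < m"
        by linarith+
      moreover from this have "2 * b mod m = 2 * b - m"
        by (simp add: le_mod_geq)
      ultimately show ?thesis
        using \<open>b < m\<close> by (simp add: late_row_def B_def[symmetric])
    qed
  qed
  moreover have "finite (late_row m h A)"
    by (rule finite_subset[of _ "{..<m}"]) (auto simp: late_row_def)
  ultimately have "card (?I \<union> ?J) \<le> card (late_row m h A)"
    by (intro card_mono)
  moreover have "h \<le> (m + B + 1) div 2"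
    unfolding h by (intro div_le_mono) simp
  then have "?I \<inter> ?J = {}"
    by (simp add: disjoint_iff)
  then have "card (?I \<union> ?J) = card ?I + card ?J"
    by (intro card_Un_disjoint) simp_all
  moreover have "(h - (B + 1) div 2) + (m - (m + B + 1) div 2) = m - B"
  proof (cases "even B")
    case True
    then obtain c where c: "B = 2 * c"
      by blast
    then have "(B + 1) div 2 = c" "(m + B + 1) div 2 = c + h"
      unfolding h by simp_all
    moreover have "c \<le> h" "c + h \<le> m"
      using B(1) two_halves[OF h] c by linarith+
    ultimately show ?thesis
      using c by linarith
  next
    case False
    then obtain c d where c: "B = 2 * c + 1" "m = 2 * d + 1"
      using B(2) by (meson oddE)
    then have "(B + 1) div 2 = c + 1" "(m + B + 1) div 2 = c + d + 1" "h = d + 1"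
      unfolding h by simp_all
    then show ?thesis
      using c B(1) by simp
  qed
  moreover have "min (int h) (int m - int A) = int (m - B)"
    using True two_halves[OF h] unfolding B_def by linarith
  ultimately show ?thesis by simp
qed auto

lemma sum_early_rows:
  fixes h k :: nat
  assumes "k \<le> h"
  shows "2 * (\<Sum>u<h. int (min h (u + k))) = int h ^ 2 + 2 * int h * int k - int k ^ 2 - int h + int k"
proof -
  \<comment> \<open>The cap \<open>h\<close> takes over from row \<open>a = h - k\<close>
    on.\<close>
  obtain a where a: "h = a + k"
    using assms by (metis le_add_diff_inverse2)
  have "2 * (\<Sum>u<a. int (u + k)) = int a * (int a - 1) + 2 * int a * int k"
    by (induction a) (auto simp: algebra_simps)
  moreover have "(\<Sum>u<a + j. int (min h (u + k))) = (\<Sum>u<a. int (u + k)) + int j * int h" for j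
    by (induction j) (auto simp: a algebra_simps)
  ultimately have "2 * (\<Sum>u<a + k. int (min h (u + k))) =
      int a * (int a - 1) + 2 * int a * int k + 2 * (int k * int h)"
    by presburger
  then show ?thesis
    by (simp add: a algebra_simps power2_eq_square)
qed

text \<open>The summand is \<open>min h (m - 2 * k - 2 * p)\<close> with \<open>c = 1\<close> for m
  = 4 n - 1 and \<open>c = 0\<close> for m = 4 n or 4 n + 1. The cap \<open>h\<close> is active for
  p < n - k; the last \<open>k\<close> terms fall in steps of 2.\<close>

lemma sum_late_rows:
  fixes h k n :: nat and c :: int
  assumes "k \<le> n" "c \<in> {0, 1}"
  shows "(\<Sum>p<n. min (int h) (int h - c + 2 * (int n - int k) - 2 * int p)) =
    int h * int n - int k * (int k - 1) - c * int k"
proof -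
  obtain a where a: "n = a + k"
    using assms by (metis le_add_diff_inverse2)
  have "(\<Sum>p<a. min (int h) (int h - c + 2 * (int n - int k) - 2 * int p)) = (\<Sum>p<a. int h)"
    using assms(2) by (intro sum.cong) (auto simp: a)
  then have "(\<Sum>p<a + j. min (int h) (int h - c + 2 * (int n - int k) - 2 * int p)) =
      int h * int (a + j) - int j * (int j - 1) - c * int j" for j
    using assms(2) by (induction j) (auto simp: a algebra_simps)
  from this[of k] show ?thesis
    by (simp add: a)
qed

lemma sum_lessThan_add:
  fixes f :: "nat \<Rightarrow> int"
  shows "(\<Sum>u<a + b. f u) = (\<Sum>u<a. f u) + (\<Sum>p<b. f (a + p))"
  by (induction b) auto

lemma card_staircase:
  fixes m h k :: nat
  assumes h: "h = (m + 1) div 2" and m: "odd m \<or> 4 dvd m"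
  shows "int (card (staircase m h k)) \<ge> (\<Sum>u<h. int (min h (u + k))) +
    (\<Sum>p<(m + 1) div 4. min (int h) (int m - 2 * int k - 2 * int p))"
proof -
  let ?n = "(m + 1) div 4"
  have fin: "finite (rows m h k u)" for u
    by (rule finite_subset[of _ "{..<m + h}"]) (auto simp: rows_def early_row_def late_row_def)
  have "int (card (staircase m h k)) = (\<Sum>u<h + ?n. int (card (rows m h k u)))"
    unfolding staircase_def by (subst card_SigmaI) (auto simp: fin)
  also have "\<dots> = (\<Sum>u<h. int (card (rows m h k u))) + (\<Sum>p<?n. int (card (rows m h k (h + p))))"
    by (rule sum_lessThan_add)
  also have "(\<Sum>u<h. int (card (rows m h k u))) = (\<Sum>u<h. int (min h (u + k)))"
    by (intro sum.cong) (auto simp: rows_def early_row_def)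
  finally have "int (card (staircase m h k)) =
      (\<Sum>u<h. int (min h (u + k))) + (\<Sum>p<?n. int (card (rows m h k (h + p))))" .
  moreover have "(\<Sum>p<?n. min (int h) (int m - 2 * int k - 2 * int p)) \<le>
      (\<Sum>p<?n. int (card (rows m h k (h + p))))"
  proof (rule sum_mono)
    fix p
    show "min (int h) (int m - 2 * int k - 2 * int p) \<le> int (card (rows m h k (h + p)))"
      using card_late_row[OF h m, of "2 * k + 2 * p"] by (simp add: rows_def)
  qed
  ultimately show ?thesis by linarith
qed

text \<open>Here \<open>k\<close> is m / 6 rounded up. The residue of \<open>m\<close> modulo 4
  determines \<open>h\<close> and \<open>n\<close>, which leaves a quadratic inequality in
  \<open>n\<close> and \<open>k\<close>.\<close>

lemma staircase_large:
  fixes m :: nat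
  assumes m: "odd m \<or> 4 dvd m" "m > 0"
  shows "24 * int (card (staircase m ((m + 1) div 2) ((m + 5) div 6))) \<ge> 7 * int m ^ 2"
proof -
  define h k n where "h = (m + 1) div 2" and "k = (m + 5) div 6" and "n = (m + 1) div 4"
  \<comment> \<open>\<open>w\<close> is the rounding error of \<open>k\<close>; the loss is quadratic in \<open>w\<close> and, up to linear terms, is
    controlled by the products bounded below.\<close>
  define w where "w = 6 * int k - 4 * int n"
  have "k \<le> h"
    unfolding h_def k_def by linarith
  define early where "early = int h ^ 2 + 2 * int h * int k - int k ^ 2 - int h + int k"
  have card: "2 * int (card (staircase m h k)) \<ge> early + 2 * late"
    if "late \<le> (\<Sum>p<n. min (int h) (int m - 2 * int k - 2 * int p))" for late
    using card_staircase[OF h_def m(1), of k] sum_early_rows[OF \<open>k \<le> h\<close>] that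
    unfolding early_def n_def by linarith
  have k: "m \<le> 6 * k" "6 * k \<le> m + 5"
    unfolding k_def by linarith+
  have "m = 4 * n \<and> h = 2 * n \<or> m = 4 * n + 1 \<and> h = 2 * n + 1 \<or> m + 1 = 4 * n \<and> h = 2 * n"
    using m(1) unfolding h_def n_def by presburger
  then consider "m = 4 * n" "h = 2 * n" | "m = 4 * n + 1" "h = 2 * n + 1" | "m + 1 = 4 * n" "h = 2 * n"
    by blast
  then have "24 * int (card (staircase m h k)) \<ge> 7 * int m ^ 2"
  proof cases
    case 1
    have "k \<le> n"
      using k 1 m by linarith
    then have "2 * int (card (staircase m h k)) \<ge> early + 2 * (int h * int n - int k * (int k - 1))"
      using sum_late_rows[of k n 0 h] by (intro card) (simp add: 1 algebra_simps)
    \<comment> \<open>Here \<open>w = 6 * k - m\<close> lies between 0 and 5, and the product is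
      exactly the surplus of the lower bound over 7 m^2.\<close>
    moreover have "w * (6 - w) \<ge> 0"
      using k 1 by (simp add: w_def)
    ultimately show ?thesis
      by (simp add: 1 w_def early_def algebra_simps power2_eq_square)
  next
    case 2
    have "(\<Sum>p<n. min (int h) (int m - 2 * int k - 2 * int p)) \<ge> int h * int n - int k * (int k - 1)"
    proof (cases "k \<le> n")
      case True
      from sum_late_rows[OF this, of 0 h] show ?thesis
        by (simp add: 2 algebra_simps)
    next
      case False
      \<comment> \<open>Rounding pushes \<open>k\<close> above \<open>n\<close> only for m = 1,
        where there are no late rows.\<close>
      then have "n = 0" "k = 1"
        using k 2 by linarith+
      then show ?thesis by simp
    qed
    then have "2 * int (card (staircase m h k)) \<ge> early + 2 * (int h * int n - int k * (int k - 1))"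
      by (rule card)
    moreover have "(w - 1) * (9 - w) \<ge> 0"
      using k 2 by (simp add: w_def)
    ultimately show ?thesis
      by (simp add: 2 w_def early_def algebra_simps power2_eq_square)
  next
    case 3
    have m_eq: "int m = 4 * int n - 1"
      using 3 by simp
    have "k \<le> n"
      using k 3 by linarith
    then have "2 * int (card (staircase m h k)) \<ge> early + 2 * (int h * int n - int k * int k)"
      using sum_late_rows[of k n 1 h] by (intro card) (simp add: m_eq 3(2) algebra_simps)
    moreover have "(w + 1) * (4 - w) \<ge> 0"
      using k 3 by (simp add: w_def)
    \<comment> \<open>The surplus is the previous product plus 40 n - 11 - w.\<close>
    moreover have "40 * int n \<ge> 11 + w"
      using k 3 m(2) by (simp add: w_def)
    ultimately show ?thesis
      by (simp add: m_eq 3(2) w_def early_def algebra_simps power2_eq_square)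
  qed
  then show ?thesis
    by (simp add: h_def k_def)
qed

theorem proposition2p5:
  fixes m :: nat
  assumes "m > 0"
  shows "\<exists>S. S \<subseteq> residue_space m 2 \<and> non_mid_point_reducible m 2 S \<and>
           real (card S) \<ge> 7 / 24 * (real m)\<^sup>2"
proof -
  have direct: "\<exists>P r. ranked n P r \<and> 24 * int (card P) \<ge> 7 * int n ^ 2"
    if "odd n \<or> 4 dvd n" "n > 0" for n
    using ranked_staircase[OF refl that(2)] staircase_large[OF that] by blast
  have "\<exists>P r. ranked m P r \<and> 24 * int (card P) \<ge> 7 * int m ^ 2"
  proof (cases "odd m \<or> 4 dvd m")
    case True
    then show ?thesis
      using direct assms by blast
  next
    case False
    then obtain n where n: "m = 2 * n" "odd n"
      by auto
    then obtain P r where "ranked n P r" "24 * int (card P) \<ge> 7 * int n ^ 2"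
      using direct[of n] assms by auto
    moreover from this obtain P' r' where "ranked m P' r'" "card P' = 4 * card P"
      using ranked_double n by blast
    ultimately show ?thesis
      by (intro exI[of _ P'] exI[of _ r']) (simp add: n power_mult_distrib)
  qed
  then obtain P r where P: "ranked m P r" "24 * int (card P) \<ge> 7 * int m ^ 2"
    by blast
  then have "real_of_int (7 * int m ^ 2) \<le> real_of_int (24 * int (card P))"
    by (simp only: of_int_le_iff)
  then have "7 / 24 * (real m)\<^sup>2 \<le> real (card P)"
    by simp
  moreover obtain S where "S \<subseteq> residue_space m 2" "non_mid_point_reducible m 2 S" "card S = card P"
    using non_mid_point_reducible_if_ranked[OF P(1)] by blast
  ultimately show ?thesis
    by (intro exI[of _ S]) simp
qed

end
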